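(* Let $(C_n)_{n\in\mathbb{N}}$ be a family of XOR-circuits, $C_n$ over the $n$-dimensional hypercube $\mathcal{H}_n$, such that for all $n$: (1) $|V_{C_n}|$ is polynomial in $2^n$ (there is a polynomial $p$ with $|V_{C_n}|\le p(2^n)$ for all $n$); (2) every permutation $\pi\in\mathrm{Sym}_n$ acting on $\{0,1\}^n$ extends to an automorphism of $C_n$; (3) there is a function $f(n)\in O(n)$ such that for all sufficiently large $n$, for every gate $g$ of $C_n$ and every parent $h$ of $g$, both $|\mathrm{Orbit}_{(g)}(h)|\le f(n)$ and $|\mathrm{Orbit}_{(h)}(g)|\le f(n)$. Then for every constant $\varepsilon>0$ and all sufficiently large $n$ the following holds: if $C_n$ is sensitive to an input gate $g$ with $\ell(g)=\{u,v\}$, then at least one of $u,v$ contains fewer than $\varepsilon n$ ones or fewer than $\varepsilon n$ zeros.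
   Context: $\mathcal{H}_n$ has vertex set $\{0,1\}^n$, with $u,v$ adjacent iff they differ in exactly one position. $\mathrm{Sym}_n$ acts on $\{0,1\}^n$ by $\pi(v_1\dots v_n)=v_{\pi^{-1}(1)}\dots v_{\pi^{-1}(n)}$ and hence on edges of $\mathcal{H}_n$. An XOR-circuit over $\mathcal{H}_n$ is a finite connected DAG $C=(V_C,E_C)$ with a unique designated root; a wire $(g,h)\in E_C$ means $h$ is a child of $g$ and $g$ a parent of $h$. Leaves are input gates, injectively labelled by $\ell$ with edges of $\mathcal{H}_n$; internal gates compute the XOR of their children; the output is the value of the root. $C$ is sensitive to an input gate $g$ if flipping the input bit of $g$ (with all other input bits fixed) changes the output. $\mathrm{Aut}(C_n)$ is the set of automorphisms $\sigma$ of the rooted DAG $(V_{C_n},E_{C_n})$ for which there is $\pi\in\mathrm{Sym}_n$ with $\ell(\sigma(g))=\pi(\ell(g))$ for every input gate $g$; we then say $\pi$ extends to $\sigma$. For gates $g,h$: $\mathrm{Orbit}_{(g)}(h):=\{\sigma(h)\mid \sigma\in\mathrm{Aut}(C_n),\ \sigma(g)=g\}$ and $\mathrm{Orbit}_{(h)}(g):=\{\sigma(g)\mid\sigma\in\mathrm{Aut}(C_n),\ \sigma(h)=h\}$. *)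

theory Defs
  imports
    Complex_Main
    "HOL-Library.Landau_Symbols"
    "HOL-Computational_Algebra.Polynomial"
    "HOL-Combinatorics.Permutations"
begin

text \<open>Words in \<open>{0,1}\<^sup>n\<close> are Boolean lists of length \<open>n\<close>, with positions \<open>0, \<dots>, n - 1\<close>.\<close>

definition cube_verts :: "nat \<Rightarrow> bool list set" where
  "cube_verts n = {v. length v = n}"

definition cube_edges :: "nat \<Rightarrow> bool list set set" where
  "cube_edges n = {{u, v} | u v. u \<in> cube_verts n \<and> v \<in> cube_verts n \<and>
      card {i. i < n \<and> u ! i \<noteq> v ! i} = 1}"

text \<open>Position \<open>i\<close> of \<open>act_vert \<pi> v\<close> is \<open>v ! inv \<pi> i\<close>.\<close>

definition act_vert :: "(nat \<Rightarrow> nat) \<Rightarrow> bool list \<Rightarrow> bool list" where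
  "act_vert \<pi> v = permute_list (inv \<pi>) v"

definition act_edge :: "(nat \<Rightarrow> nat) \<Rightarrow> bool list set \<Rightarrow> bool list set" where
  "act_edge \<pi> e = act_vert \<pi> ` e"

definition num_ones :: "bool list \<Rightarrow> nat" where
  "num_ones v = card {i. i < length v \<and> v ! i}"

definition num_zeros :: "bool list \<Rightarrow> nat" where
  "num_zeros v = card {i. i < length v \<and> \<not> v ! i}"

text \<open>A wire \<open>(g, h)\<close> leads from the parent \<open>g\<close> to its child \<open>h\<close>. The labelling \<open>elabel\<close> is
  relevant only on input gates.\<close>

record 'g circuit =
  gates :: "'g set"
  wires :: "('g \<times> 'g) set"
  root_gate :: 'g
  elabel :: "'g \<Rightarrow> bool list set"

definition children :: "'g circuit \<Rightarrow> 'g \<Rightarrow> 'g set" where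
  "children C g = {h. (g, h) \<in> wires C}"

definition parents :: "'g circuit \<Rightarrow> 'g \<Rightarrow> 'g set" where
  "parents C g = {h. (h, g) \<in> wires C}"

definition input_gates :: "'g circuit \<Rightarrow> 'g set" where
  "input_gates C = {g \<in> gates C. children C g = {}}"

definition xor_circuit :: "nat \<Rightarrow> 'g circuit \<Rightarrow> bool" where
  "xor_circuit n C \<longleftrightarrow>
     finite (gates C) \<and>
     wires C \<subseteq> gates C \<times> gates C \<and>
     acyclic (wires C) \<and>
     (\<forall>g\<in>gates C. \<forall>h\<in>gates C. (g, h) \<in> (wires C \<union> (wires C)\<inverse>)\<^sup>*) \<and>
     root_gate C \<in> gates C \<and>
     (\<forall>g\<in>gates C. parents C g = {} \<longleftrightarrow> g = root_gate C) \<and>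
     elabel C ` input_gates C \<subseteq> cube_edges n \<and>
     inj_on (elabel C) (input_gates C)"

text \<open>An input \<open>x\<close> assigns a bit to every edge of the hypercube. Gates are evaluated by
  recursion from a gate to its children, which is well-founded in a finite acyclic graph.\<close>

definition gate_val :: "'g circuit \<Rightarrow> (bool list set \<Rightarrow> bool) \<Rightarrow> 'g \<Rightarrow> bool" where
  "gate_val C x = wfrec ((wires C)\<inverse>)
     (\<lambda>val g. if children C g = {} then x (elabel C g)
              else odd (card {h \<in> children C g. val h}))"

lemma gate_val_unfold:
  assumes "xor_circuit n C"
  shows "gate_val C x g =
    (if children C g = {} then x (elabel C g)
     else odd (card {h \<in> children C g. gate_val C x h}))"
proof -
  have "finite (wires C)"
    using assms unfolding xor_circuit_def by (meson finite_SigmaI finite_subset)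
  then have "wf ((wires C)\<inverse>)"
    using assms unfolding xor_circuit_def by (simp add: finite_acyclic_wf_converse)
  note * = def_wfrec[OF gate_val_def[THEN eq_reflection] this, of x g]
  have "{h \<in> children C g. cut (gate_val C x) ((wires C)\<inverse>) g h}
      = {h \<in> children C g. gate_val C x h}"
    by (auto simp: children_def cut_def)
  with * show ?thesis by simp
qed

definition circuit_output :: "'g circuit \<Rightarrow> (bool list set \<Rightarrow> bool) \<Rightarrow> bool" where
  "circuit_output C x = gate_val C x (root_gate C)"

text \<open>Labels being injective, the bit of the edge \<open>elabel C g\<close> is the input bit of \<open>g\<close> alone.\<close>

definition sensitive_to :: "'g circuit \<Rightarrow> 'g \<Rightarrow> bool" where
  "sensitive_to C g \<longleftrightarrow>
     (\<exists>x. circuit_output C (x(elabel C g := \<not> x (elabel C g))) \<noteq> circuit_output C x)"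

definition rooted_dag_aut :: "'g circuit \<Rightarrow> ('g \<Rightarrow> 'g) \<Rightarrow> bool" where
  "rooted_dag_aut C \<sigma> \<longleftrightarrow>
     \<sigma> permutes gates C \<and>
     (\<forall>g\<in>gates C. \<forall>h\<in>gates C. (\<sigma> g, \<sigma> h) \<in> wires C \<longleftrightarrow> (g, h) \<in> wires C) \<and>
     \<sigma> (root_gate C) = root_gate C"

definition extends_to :: "'g circuit \<Rightarrow> (nat \<Rightarrow> nat) \<Rightarrow> ('g \<Rightarrow> 'g) \<Rightarrow> bool" where
  "extends_to C \<pi> \<sigma> \<longleftrightarrow>
     rooted_dag_aut C \<sigma> \<and>
     (\<forall>g\<in>input_gates C. elabel C (\<sigma> g) = act_edge \<pi> (elabel C g))"

definition circuit_aut :: "nat \<Rightarrow> 'g circuit \<Rightarrow> ('g \<Rightarrow> 'g) set" where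
  "circuit_aut n C = {\<sigma>. \<exists>\<pi>. \<pi> permutes {..<n} \<and> extends_to C \<pi> \<sigma>}"

text \<open>\<open>stab_orbit n C g h\<close> is the orbit of \<open>h\<close> under the stabiliser of \<open>g\<close>.\<close>

definition stab_orbit :: "nat \<Rightarrow> 'g circuit \<Rightarrow> 'g \<Rightarrow> 'g \<Rightarrow> 'g set" where
  "stab_orbit n C g h = {\<sigma> h | \<sigma>. \<sigma> \<in> circuit_aut n C \<and> \<sigma> g = g}"

end

theory Submission
  imports Defs "HOL-Combinatorics.Cycles" "HOL-Real_Asymp.Real_Asymp"
begin

text \<open>Let \<open>g\<close> be a sensitive input gate with label \<open>{u, v}\<close>, and let \<open>\<tau>\<close> be an involution of the
  positions that fixes \<open>u\<close> and \<open>v\<close> and moves all but at most three positions. Some extension \<open>\<sigma>\<close>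
  of \<open>\<tau>\<close> has \<open>2\<close>-power order. Below a \<open>\<sigma>\<close>-fixed gate whose value is affected by \<open>g\<close>, an odd number
  of children is affected, so \<open>\<sigma>\<close> fixes one of them; hence \<open>\<sigma>\<close> fixes a path from the root to \<open>g\<close>
  gate by gate.

  For a gate \<open>h\<close> let \<open>G\<^sub>h\<close> be the group of the permutations of the positions that have an
  extension fixing \<open>h\<close>; thus \<open>\<tau> \<in> G\<^sub>h\<close> along the path. Let \<open>\<Omega>\<close> be the set of positions moved by
  \<open>\<tau>\<close>. Then \<open>G\<^sub>h\<close> contains the alternating group of \<open>\<Omega>\<close> along the path: this holds at the root,
  and from a gate to its child the index is \<open>O(n)\<close>. For such a subgroup \<open>H\<close>, comparing more than
  \<open>O(n)\<close> double transpositions \<open>(c a) (d b)\<close> yields elements of \<open>H\<close> that move \<open>c\<close> or \<open>d\<close> into a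
  prescribed block. Two suitable ones have supports meeting in a single point, so that their
  commutator is a three-cycle. Call two points linked if a three-cycle in \<open>H\<close> takes one to the
  other. This is an equivalence relation, one of its classes contains all but at most one point of
  \<open>\<Omega>\<close>, and \<open>\<tau>\<close> preserves this class but fixes no point of \<open>\<Omega>\<close>.

  At \<open>g\<close> this is absurd as soon as \<open>u\<close> has three ones and three zeros, since a three-cycle mixing
  ones and zeros does not stabilise \<open>{u, v}\<close>.\<close>

section \<open>Three-cycles\<close>

definition three_cycle :: "'a \<Rightarrow> 'a \<Rightarrow> 'a \<Rightarrow> 'a \<Rightarrow> 'a" where
  "three_cycle a b c = cycle_of_list [a, b, c]"

lemma three_cycle_apply [simp]:
  "distinct [a, b, c] \<Longrightarrow> three_cycle a b c a = b"
  "distinct [a, b, c] \<Longrightarrow> three_cycle a b c b = c"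
  "distinct [a, b, c] \<Longrightarrow> three_cycle a b c c = a"
  "x \<notin> {a, b, c} \<Longrightarrow> three_cycle a b c x = x"
  by (auto simp: three_cycle_def transpose_def)

lemma three_cycle_rotate: "distinct [a, b, c] \<Longrightarrow> three_cycle b c a = three_cycle a b c"
  by (auto simp: three_cycle_def transpose_def fun_eq_iff)

lemma three_cycle_permutes: "three_cycle a b c permutes {a, b, c}"
  using cycle_permutes[of "[a, b, c]"] by (simp add: three_cycle_def)

lemma inv_three_cycle: "inv (three_cycle a b c) = three_cycle c b a"
  by (simp add: three_cycle_def o_inv_distrib transpose_commute)

lemma conjugation_of_three_cycle:
  "bij p \<Longrightarrow> distinct [a, b, c] \<Longrightarrow> p \<circ> three_cycle a b c \<circ> inv p = three_cycle (p a) (p b) (p c)"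
  using conjugation_of_cycle[of "[a, b, c]" p] unfolding three_cycle_def by simp

lemma images_if_supports_meet:
  assumes "bij t" "bij u" and meet: "{x. t x \<noteq> x} \<inter> {x. u x \<noteq> x} = {z}"
  shows "t (u z) = u z" "u (t z) = t z" "distinct [z, t z, u z]"
proof -
  have inj: "t x = t y \<longleftrightarrow> x = y" "u x = u y \<longleftrightarrow> x = y" for x y
    using assms(1,2) by (auto simp: bij_is_inj inj_eq)
  have only: "t x = x \<or> u x = x" if "x \<noteq> z" for x using meet that by auto
  show "t (u z) = u z" and utz: "u (t z) = t z"
    using only[of "u z"] only[of "t z"] meet inj by auto
  show "distinct [z, t z, u z]" using utz meet inj by force
qed

lemma commutator_eq_three_cycle:
  assumes "bij t" "bij u" and meet: "{x. t x \<noteq> x} \<inter> {x. u x \<noteq> x} = {z}"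
  shows "t \<circ> u \<circ> inv t \<circ> inv u = three_cycle z (t z) (u z)"
proof -
  have inj: "t x = t y \<longleftrightarrow> x = y" "u x = u y \<longleftrightarrow> x = y" for x y
    using assms(1,2) by (auto simp: bij_is_inj inj_eq)
  note images = images_if_supports_meet[OF assms]
  have t_fix: "t x = x" if "u x \<noteq> x" "x \<noteq> z" for x using meet that by auto
  have u_fix: "u x = x" if "t x \<noteq> x" "x \<noteq> z" for x using meet that by auto
  have "t (u x) = three_cycle z (t z) (u z) (u (t x))" for x
  proof -
    consider (common) "x = z" | (t_preimage) "t x = z" "x \<noteq> z" | (u_preimage) "u x = z" "x \<noteq> z"
      | (other) "x \<noteq> z" "t x \<noteq> z" "u x \<noteq> z"
      by blast
    then show ?thesis
    proof cases
      case common
      then show ?thesis using images by simp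
    next
      case t_preimage
      then show ?thesis using u_fix[of x] images(3) by simp
    next
      case u_preimage
      then show ?thesis using t_fix[of x] images(3) by simp
    next
      case other
      have "t (u x) = u (t x) \<and> u (t x) \<notin> {z, t z, u z}"
      proof (cases "t x = x")
        case True
        then have "u x \<noteq> t z" using images inj by (metis distinct_length_2_or_more)
        then show ?thesis using True other t_fix[of "u x"] inj by (cases "u x = x") auto
      next
        case False
        then show ?thesis using other u_fix[of x] u_fix[of "t x"] images(1) inj by auto
      qed
      then show ?thesis by simp
    qed
  qed
  from this[of "inv t (inv u y)" for y] show ?thesis
    using assms(1,2) by (simp add: fun_eq_iff bij_is_surj surj_f_inv_f)
qed

section \<open>Permutation groups\<close>

text \<open>As three-cycles generate the alternating group, for a group \<open>H\<close> this says \<open>Alt A \<le> H\<close>.\<close>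

definition contains_alt :: "('a \<Rightarrow> 'a) set \<Rightarrow> 'a set \<Rightarrow> bool" where
  "contains_alt H A \<longleftrightarrow> (\<forall>a\<in>A. \<forall>b\<in>A. \<forall>c\<in>A. distinct [a, b, c] \<longrightarrow> three_cycle a b c \<in> H)"

locale perm_group =
  fixes S :: "'a set" and H :: "('a \<Rightarrow> 'a) set"
  assumes permutes: "h \<in> H \<Longrightarrow> h permutes S"
    and comp: "h \<in> H \<Longrightarrow> k \<in> H \<Longrightarrow> h \<circ> k \<in> H"
    and inverse: "h \<in> H \<Longrightarrow> inv h \<in> H"
begin

lemma bij: "h \<in> H \<Longrightarrow> bij h"
  using permutes permutes_bij by blast

lemma three_cycle_conjugate:
  "h \<in> H \<Longrightarrow> three_cycle a b c \<in> H \<Longrightarrow> distinct [a, b, c] \<Longrightarrow> three_cycle (h a) (h b) (h c) \<in> H"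
  using conjugation_of_three_cycle[OF bij] comp inverse by metis

lemma three_cycle_reverse: "three_cycle a b c \<in> H \<Longrightarrow> three_cycle c b a \<in> H"
  using inverse[of "three_cycle a b c"] by (simp add: inv_three_cycle)

definition has_three_cycle :: "'a set \<Rightarrow> bool" where
  "has_three_cycle A \<longleftrightarrow> (\<exists>a b c. {a, b, c} \<subseteq> A \<and> distinct [a, b, c] \<and> three_cycle a b c \<in> H)"

lemma has_three_cycle_if_supports_meet:
  assumes "t \<in> H" "t permutes X" "u \<in> H" "u permutes Y" "X \<inter> Y = {z}" "t z \<noteq> z" "u z \<noteq> z"
    and "X \<union> Y \<subseteq> A"
  shows "has_three_cycle A"
proof -
  have meet: "{x. t x \<noteq> x} \<inter> {x. u x \<noteq> x} = {z}"
    using assms permutes_not_in[of t X] permutes_not_in[of u Y] by blast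
  note bijs = bij[OF assms(1)] bij[OF assms(3)]
  have "t \<circ> u \<circ> inv t \<circ> inv u \<in> H" using assms(1,3) comp inverse by simp
  then have "three_cycle z (t z) (u z) \<in> H" by (simp only: commutator_eq_three_cycle[OF bijs meet])
  moreover have "distinct [z, t z, u z]" using bijs meet by (rule images_if_supports_meet)
  moreover have "{z, t z, u z} \<subseteq> A"
    using assms(5,8) permutes_in_image[OF assms(2), of z] permutes_in_image[OF assms(4), of z]
    by auto
  ultimately show ?thesis unfolding has_three_cycle_def by blast
qed

lemma double_transposition_in:
  assumes "contains_alt H A" "{a, b, c, d} \<subseteq> A" "distinct [a, b, c, d]"
  shows "transpose a b \<circ> transpose c d \<in> H"
proof -
  have "transpose a b \<circ> transpose c d = three_cycle a b c \<circ> three_cycle b c d"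
    by (simp add: three_cycle_def fun_eq_iff)
  then show ?thesis
    using assms comp by (simp add: contains_alt_def)
qed

definition linked :: "'a \<Rightarrow> 'a \<Rightarrow> bool" where
  "linked x y \<longleftrightarrow> x = y \<or> (\<exists>z. distinct [x, y, z] \<and> three_cycle x y z \<in> H)"

lemma linked_if_three_cycle: "three_cycle x y z \<in> H \<Longrightarrow> distinct [x, y, z] \<Longrightarrow> linked x y"
  by (auto simp: linked_def)

lemma linked_refl: "linked x x"
  by (simp add: linked_def)

lemma linked_sym:
  assumes "linked x y"
  shows "linked y x"
proof (cases "x = y")
  case False
  then obtain z where "distinct [x, y, z]" "three_cycle x y z \<in> H"
    using assms by (auto simp: linked_def)
  then have "distinct [y, x, z]" "three_cycle y x z \<in> H"
    using three_cycle_reverse[of x y z] three_cycle_rotate[of z y x] by auto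
  then show ?thesis by (rule linked_if_three_cycle[rotated])
qed (simp add: linked_refl)

lemma linked_image:
  assumes "h \<in> H" "linked x y"
  shows "linked (h x) (h y)"
proof (cases "x = y")
  case False
  then obtain z where z: "distinct [x, y, z]" "three_cycle x y z \<in> H"
    using assms(2) by (auto simp: linked_def)
  then have "distinct [h x, h y, h z]"
    using bij[OF assms(1)] by (auto simp: bij_is_inj inj_eq)
  then show ?thesis
    using three_cycle_conjugate[OF assms(1) z(2,1)] linked_if_three_cycle by blast
qed (simp add: linked_refl)

lemma linked_image_iff: "h \<in> H \<Longrightarrow> linked (h x) (h y) \<longleftrightarrow> linked x y"
  using linked_image[of h] linked_image[OF inverse, of h "h x" "h y"] bij[of h]
  by (auto simp: bij_is_inj)

lemma linked_trans:
  assumes "linked x y" "linked y w"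
  shows "linked x w"
proof (cases "x = y \<or> y = w \<or> x = w")
  case False
  then obtain z where z: "distinct [x, y, z]" "three_cycle x y z \<in> H"
    using assms(1) by (auto simp: linked_def)
  have reverse: "three_cycle z y x \<in> H" using z(2) by (rule three_cycle_reverse)
  show ?thesis
  proof (cases "z = w")
    case True
    then have "three_cycle w y x \<in> H" "distinct [w, y, x]" using reverse z(1) by auto
    then show ?thesis
      using three_cycle_rotate[of w y x] three_cycle_rotate[of y x w] linked_if_three_cycle[of x w y]
      by auto
  next
    case False
    with \<open>\<not> (x = y \<or> y = w \<or> x = w)\<close> z(1)
    have "three_cycle z y x y = x" "three_cycle z y x w = w" by auto
    then show ?thesis using linked_image[OF reverse assms(2)] by simp
  qed
qed (use assms linked_refl in auto)

lemma three_cycle_if_linked: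
  assumes dist: "distinct [x, y, w]" and "linked x y" "linked y w"
  shows "three_cycle x y w \<in> H"
proof -
  obtain z where z: "distinct [x, y, z]" "three_cycle x y z \<in> H"
    using assms(1,2) by (auto simp: linked_def)
  show ?thesis
  proof (cases "z = w")
    case True
    then show ?thesis using z(2) by simp
  next
    case False
    have "linked y z"
      using z three_cycle_rotate[OF z(1)] by (intro linked_if_three_cycle[of y z x]) auto
    then have "linked z w" using assms(3) linked_sym linked_trans by blast
    then obtain v where v: "distinct [z, w, v]" "three_cycle z w v \<in> H"
      using False by (auto simp: linked_def)
    have reverse: "three_cycle v w z \<in> H" using v(2) by (rule three_cycle_reverse)
    consider (x) "v = x" | (y) "v = y" | (other) "v \<noteq> x" "v \<noteq> y" by blast
    then show ?thesis
    proof cases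
      case x
      then have "three_cycle w y x \<in> H"
        using three_cycle_conjugate[OF reverse z(2,1)] v(1) z(1) dist by auto
      then show ?thesis by (rule three_cycle_reverse)
    next
      case y
      then have "three_cycle x w y \<in> H"
        using three_cycle_conjugate[OF reverse z(2,1)] v(1) z(1) dist by auto
      then have "three_cycle y w x \<in> H" by (rule three_cycle_reverse)
      then show ?thesis using three_cycle_rotate[of x y w] three_cycle_rotate[of y w x] dist by auto
    next
      case other
      then show ?thesis using three_cycle_conjugate[OF v(2) z(2,1)] v(1) z(1) dist by auto
    qed
  qed
qed

lemma contains_alt_if_linked:
  "(\<And>x y. x \<in> A \<Longrightarrow> y \<in> A \<Longrightarrow> linked x y) \<Longrightarrow> contains_alt H A"
  using three_cycle_if_linked by (simp add: contains_alt_def)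

end

section \<open>Subgroups of small index\<close>

text \<open>For groups \<open>H \<subseteq> G\<close> this says that \<open>H\<close> has fewer than \<open>k\<close> cosets in \<open>G\<close>, phrased as a
  pigeonhole principle.\<close>

definition index_less :: "nat \<Rightarrow> ('a \<Rightarrow> 'a) set \<Rightarrow> ('a \<Rightarrow> 'a) set \<Rightarrow> bool" where
  "index_less k G H \<longleftrightarrow>
     (\<forall>X. finite X \<longrightarrow> X \<subseteq> G \<longrightarrow> k \<le> card X \<longrightarrow> (\<exists>x\<in>X. \<exists>y\<in>X. x \<noteq> y \<and> inv x \<circ> y \<in> H))"

lemma index_less_collision:
  assumes "index_less k G H" "finite A" "k \<le> card A" "inj_on x A" "x ` A \<subseteq> G"
  shows "\<exists>p\<in>A. \<exists>p'\<in>A. p \<noteq> p' \<and> inv (x p) \<circ> x p' \<in> H"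
proof -
  have "\<exists>y\<in>x ` A. \<exists>y'\<in>x ` A. y \<noteq> y' \<and> inv y \<circ> y' \<in> H"
    using assms by (intro assms(1)[unfolded index_less_def, rule_format]) (simp_all add: card_image)
  then obtain p p' where "p \<in> A" "p' \<in> A" "x p \<noteq> x p'" "inv (x p) \<circ> x p' \<in> H" by auto
  then show ?thesis by metis
qed

lemma obtain_disjoint_subsets_and_four_points:
  assumes "finite A" "2 * k + 4 \<le> card A"
  obtains D E c d e f where "D \<subseteq> A" "card D = k" "E \<subseteq> A - D" "card E = k"
    "{c, d, e, f} \<subseteq> A - D - E" "distinct [c, d, e, f]"
proof -
  obtain D where D: "D \<subseteq> A" "card D = k"
    using obtain_subset_with_card_n[of k A] assms(2) by auto
  have card_D: "k + 4 \<le> card (A - D)"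
    using D assms by (simp add: card_Diff_subset finite_subset)
  then obtain E where E: "E \<subseteq> A - D" "card E = k"
    using obtain_subset_with_card_n[of k "A - D"] by auto
  define W where "W = A - D - E"
  have "4 \<le> card W"
    using E card_D assms(1) by (simp add: W_def card_Diff_subset finite_subset)
  then obtain c d e f where "{c, d, e, f} \<subseteq> W" "distinct [c, d, e, f]"
    by (auto simp: numeral_eq_Suc card_le_Suc_iff)
  then show thesis using that D E by (simp add: W_def)
qed

locale small_index_subgroup =
  G: perm_group S G + H: perm_group S H
  for S :: "'a set" and G H :: "('a \<Rightarrow> 'a) set" +
  fixes \<Omega> :: "'a set" and q :: nat
  assumes contains_alt_\<Omega>: "contains_alt G \<Omega>" and index: "index_less (q * q) G H"
    and finite_\<Omega>: "finite \<Omega>" and card_\<Omega>: "4 * q + 4 \<le> card \<Omega>"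
begin

lemma ex_element_moving_pair:
  assumes cd: "c \<in> \<Omega>" "d \<in> \<Omega>" "c \<noteq> d" and D: "D \<subseteq> \<Omega> - {c, d}" "2 * q \<le> card D"
  shows "\<exists>t\<in>H. t permutes insert c (insert d D) \<and> (t c \<in> D \<or> t d \<in> D)"
proof -
  obtain P where P: "P \<subseteq> D" "card P = q"
    using obtain_subset_with_card_n[of q D] D(2) by auto
  define Q where "Q = D - P"
  have fin: "finite P" "finite Q"
    using P(1) D(1) finite_\<Omega> by (auto simp: Q_def intro: finite_subset)
  then have "q \<le> card Q" using P D(2) by (simp add: Q_def card_Diff_subset)
  then have card_PQ: "q * q \<le> card (P \<times> Q)" by (simp add: card_cartesian_product P(2))
  define swaps where "swaps = (\<lambda>(a, b). transpose c a \<circ> transpose d b)"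
  have distinct: "distinct [c, a, d, b]" "{c, a, d, b} \<subseteq> \<Omega>" "{a, b} \<subseteq> D" if "a \<in> P" "b \<in> Q" for a b
    using that cd D(1) P(1) by (auto simp: Q_def)
  have swaps: "swaps (a, b) c = a" "swaps (a, b) d = b" "swaps (a, b) \<in> G"
    if "a \<in> P" "b \<in> Q" for a b
    using distinct[OF that] G.double_transposition_in[OF contains_alt_\<Omega>, of c a d b]
    by (auto simp: swaps_def)
  have perm: "swaps (a, b) permutes insert c (insert d D)" if "a \<in> P" "b \<in> Q" for a b
    using distinct(3)[OF that] by (auto simp: swaps_def intro!: permutes_compose permutes_swap_id)
  have "inj_on swaps (P \<times> Q)" by (rule inj_onI) (metis swaps(1,2) SigmaE)
  moreover have "swaps ` (P \<times> Q) \<subseteq> G" using swaps(3) by auto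
  ultimately obtain p p' where "p \<in> P \<times> Q" "p' \<in> P \<times> Q" "p \<noteq> p'" "inv (swaps p) \<circ> swaps p' \<in> H"
    using index_less_collision[OF index _ card_PQ, of swaps] fin by blast
  then obtain a b a' b' where ab: "a \<in> P" "b \<in> Q" "a' \<in> P" "b' \<in> Q" "a' \<noteq> a \<or> b' \<noteq> b"
    and in_H: "inv (swaps (a, b)) \<circ> swaps (a', b') \<in> H"
    by blast
  have fixed: "inv (swaps (a, b)) e = e" if "e \<in> D" "e \<noteq> a" "e \<noteq> b" for e
  proof -
    have "e \<notin> {a, b, c, d}" using that D(1) by auto
    then have "swaps (a, b) e = e" by (simp add: swaps_def)
    then show ?thesis using permutes_inverses(2)[OF perm[OF ab(1,2)]] by metis
  qed
  have "{a', b'} \<subseteq> D" "a' \<noteq> b" "b' \<noteq> a" using ab(1-4) P(1) by (auto simp: Q_def)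
  then have "inv (swaps (a, b)) a' \<in> D \<or> inv (swaps (a, b)) b' \<in> D"
    using fixed[of a'] fixed[of b'] ab(5) by auto
  then have "(inv (swaps (a, b)) \<circ> swaps (a', b')) c \<in> D \<or>
      (inv (swaps (a, b)) \<circ> swaps (a', b')) d \<in> D"
    using swaps(1,2) ab(3,4) by simp
  then show ?thesis
    using in_H permutes_compose[OF perm[OF ab(3,4)] permutes_inv[OF perm[OF ab(1,2)]]] by blast
qed

lemma has_three_cycle_or_ex_confined_element:
  assumes t: "t \<in> H" "t permutes X" "X \<subseteq> \<Omega>" and x: "x \<in> X" "t x \<noteq> x"
    and D: "D \<subseteq> \<Omega> - X" "2 * q \<le> card D" and w: "w \<in> \<Omega> - X - D"
  shows "H.has_three_cycle \<Omega> \<or> (\<exists>u\<in>H. u permutes insert w D \<and> u w \<noteq> w)"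
proof -
  have "x \<in> \<Omega>" "x \<noteq> w" "D \<subseteq> \<Omega> - {x, w}" using t(3) x(1) D(1) w by auto
  then obtain u where u: "u \<in> H" "u permutes insert x (insert w D)" "u x \<in> D \<or> u w \<in> D"
    using ex_element_moving_pair[of x w D] D(2) w by auto
  show ?thesis
  proof (cases "u x = x")
    case True
    then have "u permutes insert w D" by (intro permutes_superset[OF u(2)]) auto
    moreover have "u w \<noteq> w" using u(3) True x(1) D(1) w by auto
    ultimately show ?thesis using u(1) by blast
  next
    case False
    have "X \<inter> insert x (insert w D) = {x}" "X \<union> insert x (insert w D) \<subseteq> \<Omega>"
      using t(3) x(1) D(1) w by auto
    then show ?thesis
      using H.has_three_cycle_if_supports_meet[OF t(1,2) u(1,2) _ x(2) False] by blast
  qed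
qed

lemma subgroup_has_three_cycle: "H.has_three_cycle \<Omega>"
proof -
  have "2 * (2 * q) + 4 \<le> card \<Omega>" using card_\<Omega> by simp
  then obtain D E c d e f where D: "D \<subseteq> \<Omega>" "card D = 2 * q" and E: "E \<subseteq> \<Omega> - D" "card E = 2 * q"
    and points: "{c, d, e, f} \<subseteq> \<Omega> - D - E" "distinct [c, d, e, f]"
    by (rule obtain_disjoint_subsets_and_four_points[OF finite_\<Omega>])
  have sub: "D \<subseteq> \<Omega> - {c, d}" "D \<subseteq> \<Omega> - {e, f}" using D(1) points(1) by auto
  obtain t where t: "t \<in> H" "t permutes insert c (insert d D)" "t c \<in> D \<or> t d \<in> D"
    using ex_element_moving_pair[OF _ _ _ sub(1)] D(2) points by auto
  obtain t' where t': "t' \<in> H" "t' permutes insert e (insert f D)" "t' e \<in> D \<or> t' f \<in> D"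
    using ex_element_moving_pair[OF _ _ _ sub(2)] D(2) points by auto
  obtain x where x: "x \<in> {c, d}" "t x \<noteq> x" using t(3) sub(1) by blast
  obtain w where w: "w \<in> {e, f}" "t' w \<noteq> w" using t'(3) sub(2) by blast
  have "H.has_three_cycle \<Omega> \<or> (\<exists>u\<in>H. u permutes insert w E \<and> u w \<noteq> w)"
  proof (rule has_three_cycle_or_ex_confined_element[OF t(1,2) _ _ x(2)])
    show "insert c (insert d D) \<subseteq> \<Omega>" "x \<in> insert c (insert d D)"
      "E \<subseteq> \<Omega> - insert c (insert d D)" "w \<in> \<Omega> - insert c (insert d D) - E"
      using D(1) E(1) points x(1) w(1) by auto
  qed (simp add: E(2))
  moreover have "insert e (insert f D) \<inter> insert w E = {w}" "insert e (insert f D) \<union> insert w E \<subseteq> \<Omega>"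
    using D(1) E(1) points w(1) by auto
  then have "H.has_three_cycle \<Omega>" if "u \<in> H" "u permutes insert w E" "u w \<noteq> w" for u
    using H.has_three_cycle_if_supports_meet[OF t'(1,2) that(1,2) _ w(2) that(3)] by blast
  ultimately show ?thesis by blast
qed

lemma card_not_linked_less:
  assumes "{a, b, c} \<subseteq> \<Omega>" "distinct [a, b, c]" "H.linked a b" "H.linked a c"
  shows "card {x \<in> \<Omega>. \<not> H.linked a x} < 2 * q"
proof (rule ccontr)
  let ?D = "{x \<in> \<Omega>. \<not> H.linked a x}"
  assume "\<not> card ?D < 2 * q"
  moreover have "?D \<subseteq> \<Omega> - {a, b}" using assms(3) H.linked_refl by auto
  ultimately obtain t where t: "t \<in> H" "t permutes insert a (insert b ?D)" "t a \<in> ?D \<or> t b \<in> ?D"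
    using ex_element_moving_pair[of a b ?D] assms(1,2) by auto
  have "t c = c" using t(2) assms(2,4) by (auto dest: permutes_not_in[of _ _ c])
  then have "H.linked a (t a)" "H.linked a (t b)"
    using H.linked_image[OF t(1)] assms(3,4) H.linked_sym H.linked_trans by metis+
  then show False using t(3) by blast
qed

lemma card_linked_le:
  assumes cd: "c \<in> \<Omega>" "d \<in> \<Omega>" "c \<noteq> d" "\<not> H.linked a c" "\<not> H.linked a d"
  shows "card {x \<in> \<Omega>. H.linked a x} \<le> 2 * q"
proof (rule ccontr)
  assume large: "\<not> ?thesis"
  then obtain D where D: "D \<subseteq> {x \<in> \<Omega>. H.linked a x}" "card D = 2 * q"
    using obtain_subset_with_card_n[of "2 * q" "{x \<in> \<Omega>. H.linked a x}"] by auto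
  then have "D \<noteq> {x \<in> \<Omega>. H.linked a x}" using large by auto
  then obtain e where e: "e \<in> \<Omega>" "H.linked a e" "e \<notin> D" using D(1) by blast
  have "D \<subseteq> \<Omega> - {c, d}" using D(1) cd by auto
  then obtain t where t: "t \<in> H" "t permutes insert c (insert d D)" "t c \<in> D \<or> t d \<in> D"
    using ex_element_moving_pair[of c d D] cd D(2) by auto
  have "t e = e" using permutes_not_in[OF t(2), of e] e cd by auto
  have "H.linked a x" if "t x \<in> D" for x
  proof -
    have "H.linked e (t x)" using that D(1) e(2) H.linked_sym H.linked_trans by blast
    then have "H.linked e x" using H.linked_image_iff[OF t(1), of e x] \<open>t e = e\<close> by simp
    then show ?thesis using e(2) H.linked_trans by blast
  qed
  then show False using t(3) cd(4,5) by blast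
qed

lemma contains_alt_if_fixed_point_free_element:
  assumes \<tau>: "\<tau> \<in> H" "\<And>x. x \<in> \<Omega> \<Longrightarrow> \<tau> x \<in> \<Omega>" "\<And>x. x \<in> \<Omega> \<Longrightarrow> \<tau> x \<noteq> x"
  shows "contains_alt H \<Omega>"
proof -
  obtain a b c where abc: "{a, b, c} \<subseteq> \<Omega>" "distinct [a, b, c]" "three_cycle a b c \<in> H"
    using subgroup_has_three_cycle unfolding H.has_three_cycle_def by blast
  define A where "A = {x \<in> \<Omega>. H.linked a x}"
  have "H.linked a b" "H.linked b c"
    using abc(2,3) three_cycle_rotate[of a b c] by (auto intro: H.linked_if_three_cycle[rotated])
  then have "card {x \<in> \<Omega>. \<not> H.linked a x} < 2 * q"
    using card_not_linked_less[OF abc(1,2)] H.linked_trans by blast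
  moreover have "card A + card {x \<in> \<Omega>. \<not> H.linked a x} = card \<Omega>"
    using finite_\<Omega> unfolding A_def
    by (subst card_Un_disjoint[symmetric]) (auto intro: arg_cong[where f = card])
  ultimately have A: "2 * q < card A" "card \<Omega> < card A + card A" using card_\<Omega> by linarith+
  have "inj \<tau>" using H.bij[OF \<tau>(1)] by (simp add: bij_is_inj)
  then have card_\<tau>_image: "card (\<tau> ` A) = card A" by (simp add: card_image inj_on_subset)
  have "A \<inter> \<tau> ` A \<noteq> {}"
  proof
    assume "A \<inter> \<tau> ` A = {}"
    then have "card A + card A = card (A \<union> \<tau> ` A)"
      using finite_\<Omega> card_\<tau>_image by (simp add: card_Un_disjoint A_def)
    also have "\<dots> \<le> card \<Omega>" using \<tau>(2) finite_\<Omega> by (intro card_mono) (auto simp: A_def)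
    finally show False using A(2) by simp
  qed
  then obtain y where y: "H.linked a y" "H.linked a (\<tau> y)" by (auto simp: A_def)
  have stable: "H.linked a x" if "H.linked a (\<tau> x)" for x
    using that y H.linked_image_iff[OF \<tau>(1), of y x] H.linked_sym H.linked_trans by metis
  have "H.linked a x" if "x \<in> \<Omega>" for x
    using card_linked_le[of x "\<tau> x" a] stable[of x] \<tau>(2,3)[of x] that A(1) by (auto simp: A_def)
  then show ?thesis using H.contains_alt_if_linked H.linked_sym H.linked_trans by metis
qed

end

section \<open>Parity and involutions\<close>

lemma even_card_if_fixed_point_free_involution:
  assumes "finite X" "\<And>x. x \<in> X \<Longrightarrow> f x \<in> X" "\<And>x. x \<in> X \<Longrightarrow> f (f x) = x" "\<And>x. x \<in> X \<Longrightarrow> f x \<noteq> x"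
  shows "even (card X)"
proof -
  let ?orbits = "(\<lambda>x. {x, f x}) ` X"
  have Union: "\<Union> ?orbits = X" using assms(2) by auto
  have "2 * card ?orbits = card (\<Union> ?orbits)"
  proof (rule card_partition)
    show "c \<inter> d = {}" if "c \<in> ?orbits" "d \<in> ?orbits" "c \<noteq> d" for c d
      using that assms(3) by (auto, metis+)
    show "card c = 2" if "c \<in> ?orbits" for c
      using that assms(4) by (fastforce simp: card_insert_if)
  qed (use assms(1) in auto)
  then show ?thesis using Union by (metis dvd_triv_left)
qed

lemma even_card_fixed_points_iff:
  assumes "finite X" "f ` X \<subseteq> X" "\<And>x. x \<in> X \<Longrightarrow> (f ^^ 2 ^ k) x = x"
  shows "even (card {x \<in> X. f x = x}) \<longleftrightarrow> even (card X)"
  using assms(2,3)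
proof (induction k arbitrary: f)
  case 0
  then have "{x \<in> X. f x = x} = X" by auto
  then show ?case by simp
next
  case (Suc k)
  define Y F where "Y = {x \<in> X. (f \<circ> f) x = x}" and "F = {x \<in> X. f x = x}"
  have "(f \<circ> f) ^^ 2 ^ k = f ^^ 2 ^ Suc k"
    using funpow_mult[where f = f and m = 2 and n = "2 ^ k"] by (simp add: numeral_2_eq_2)
  then have "((f \<circ> f) ^^ 2 ^ k) x = x" if "x \<in> X" for x
    using Suc.prems(2)[OF that] by (simp only:)
  moreover have "(f \<circ> f) ` X \<subseteq> X" using Suc.prems(1) by auto
  ultimately have "even (card Y) \<longleftrightarrow> even (card X)" unfolding Y_def by (intro Suc.IH)
  moreover have "even (card (Y - F))"
    using assms(1) Suc.prems(1)
    by (intro even_card_if_fixed_point_free_involution[of _ f]) (auto simp: Y_def F_def)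
  moreover have "F \<subseteq> Y" "finite Y" using assms(1) by (auto simp: Y_def F_def)
  then have "card Y = card F + card (Y - F)"
    by (metis card_Diff_subset card_mono finite_subset le_add_diff_inverse)
  ultimately show ?case by (simp add: F_def)
qed

lemma odd_card_filter_neq_iff:
  assumes "finite X"
  shows "odd (card {x \<in> X. P x \<noteq> Q x}) \<longleftrightarrow> odd (card {x \<in> X. P x}) \<noteq> odd (card {x \<in> X. Q x})"
  using assms
proof (induction X)
  case (insert a X)
  have "{x \<in> insert a X. R x} = (if R a then insert a {x \<in> X. R x} else {x \<in> X. R x})" for R
    by auto
  then show ?case using insert by auto
qed simp

lemma ex_odd_power_with_two_power_order:
  assumes "\<sigma> permutes S" "finite S"
  shows "\<exists>N k. odd N \<and> (\<sigma> ^^ N) ^^ 2 ^ k = id"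
proof -
  have "permutation \<sigma>" using assms permutation_permutes by blast
  then obtain M where M: "\<sigma> ^^ M = id" "M > 0" by (rule permutation_is_nilpotent)
  then obtain N where N: "M = 2 ^ multiplicity 2 M * N" "odd N"
    using multiplicity_decompose'[of M 2] by auto
  then have "(\<sigma> ^^ N) ^^ 2 ^ multiplicity 2 M = id"
    using M(1) by (metis funpow_mult mult.commute)
  then show ?thesis using N(2) by blast
qed

lemma funpow_odd_involution:
  assumes "\<tau> \<circ> \<tau> = id" "odd N"
  shows "\<tau> ^^ N = \<tau>"
proof -
  obtain j where "N = 2 * j + 1" using assms(2) by (auto elim: oddE)
  moreover have "\<tau> ^^ (2 * j) = id"
    using funpow_mult[where f = \<tau> and m = 2 and n = j] assms(1) by (simp add: numeral_2_eq_2)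
  ultimately show ?thesis by simp
qed

lemma ex_involution_preserving:
  fixes f :: "'a \<Rightarrow> 'b"
  assumes "finite A"
  shows "\<exists>\<tau>. \<tau> permutes A \<and> \<tau> \<circ> \<tau> = id \<and> (\<forall>x. f (\<tau> x) = f x) \<and> inj_on f {x \<in> A. \<tau> x = x}"
  using assms
proof (induction "card A" arbitrary: A rule: less_induct)
  case less
  show ?case
  proof (cases "inj_on f A")
    case True
    then show ?thesis by (intro exI[of _ id]) (simp add: permutes_id)
  next
    case False
    then obtain a b where ab: "a \<in> A" "b \<in> A" "a \<noteq> b" "f a = f b" by (auto simp: inj_on_def)
    define B where "B = A - {a, b}"
    have "B \<subset> A" using ab by (auto simp: B_def)
    then have "card B < card A" using less.prems by (rule psubset_card_mono[rotated])
    then obtain \<tau> where \<tau>: "\<tau> permutes B" "\<tau> \<circ> \<tau> = id" "\<And>x. f (\<tau> x) = f x"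
      "inj_on f {x \<in> B. \<tau> x = x}"
      using less.hyps[of B] less.prems B_def by blast
    have fixed: "\<tau> a = a" "\<tau> b = b" using permutes_not_in[OF \<tau>(1)] by (auto simp: B_def)
    have inj: "\<tau> x = \<tau> y \<longleftrightarrow> x = y" for x y using permutes_inj[OF \<tau>(1)] by (simp add: inj_eq)
    have ab_iff: "\<tau> x = a \<longleftrightarrow> x = a" "\<tau> x = b \<longleftrightarrow> x = b" for x
      using inj[of x a] inj[of x b] fixed by auto
    define \<rho> where "\<rho> = transpose a b \<circ> \<tau>"
    have "\<rho> permutes A" unfolding \<rho>_def
      using ab \<tau>(1) by (intro permutes_compose permutes_swap_id)
        (auto simp: B_def intro: permutes_subset)
    moreover have "\<rho> \<circ> \<rho> = id"
      using \<tau>(2) by (auto simp: \<rho>_def fun_eq_iff transpose_def ab_iff fixed)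
    moreover have "f (transpose a b y) = f y" for y
      using ab(4) by (cases "y = a"; cases "y = b") simp_all
    then have "f (\<rho> x) = f x" for x using \<tau>(3) by (simp add: \<rho>_def)
    moreover have "{x \<in> A. \<rho> x = x} = {x \<in> B. \<tau> x = x}"
      using ab by (auto simp: \<rho>_def B_def transpose_def fixed ab_iff)
    ultimately show ?thesis using \<tau>(4) by metis
  qed
qed

lemma card_le_card_moved_plus:
  assumes "finite A" "inj_on f {x \<in> A. \<tau> x = x}" "f ` A \<subseteq> B" "finite B"
  shows "card A \<le> card {x \<in> A. \<tau> x \<noteq> x} + card B"
proof -
  have "card {x \<in> A. \<tau> x = x} = card (f ` {x \<in> A. \<tau> x = x})"
    using assms(2) by (simp add: card_image)
  also have "\<dots> \<le> card B" using assms(3,4) by (intro card_mono) auto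
  finally have "card {x \<in> A. \<tau> x = x} \<le> card B" .
  moreover have "A = {x \<in> A. \<tau> x \<noteq> x} \<union> {x \<in> A. \<tau> x = x}" by auto
  then have "card A \<le> card {x \<in> A. \<tau> x \<noteq> x} + card {x \<in> A. \<tau> x = x}"
    by (metis (lifting) card_Un_le)
  ultimately show ?thesis by linarith
qed

section \<open>The action on the hypercube\<close>

lemma act_vert_comp:
  assumes "\<pi> permutes {..<n}" "\<rho> permutes {..<n}" "length v = n"
  shows "act_vert (\<pi> \<circ> \<rho>) v = act_vert \<pi> (act_vert \<rho> v)"
  using assms
  by (simp add: act_vert_def o_inv_distrib permutes_bij permute_list_compose permutes_inv)

lemma act_edge_comp:
  assumes "\<pi> permutes {..<n}" "\<rho> permutes {..<n}" "e \<in> cube_edges n"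
  shows "act_edge (\<pi> \<circ> \<rho>) e = act_edge \<pi> (act_edge \<rho> e)"
  using assms(3) act_vert_comp[OF assms(1,2)]
  by (auto simp: act_edge_def cube_edges_def cube_verts_def)

lemma act_edge_id: "act_edge id e = e"
  by (simp add: act_edge_def act_vert_def)

lemma act_vert_nth:
  assumes "\<pi> permutes {..<n}" "length v = n" "i < n"
  shows "act_vert \<pi> v ! \<pi> i = v ! i"
proof -
  have "\<pi> i < n" using permutes_in_image[OF assms(1), of i] assms(3) by simp
  then show ?thesis
    using assms permutes_inverses(2)[OF assms(1)] permutes_inv[OF assms(1)]
    by (simp add: act_vert_def permute_list_nth)
qed

lemma act_vert_eqI:
  assumes "\<pi> permutes {..<n}" "length v = n" "\<And>i. i < n \<Longrightarrow> v ! \<pi> i = v ! i"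
  shows "act_vert \<pi> v = v"
proof (rule nth_equalityI)
  show "length (act_vert \<pi> v) = length v" by (simp add: act_vert_def)
  fix j assume "j < length (act_vert \<pi> v)"
  then have "j \<in> \<pi> ` {..<n}" using assms(2) permutes_image[OF assms(1)] by (simp add: act_vert_def)
  then obtain i where "j = \<pi> i" "i < n" by auto
  then show "act_vert \<pi> v ! j = v ! j"
    using act_vert_nth[OF assms(1,2)] assms(3) by simp
qed

lemma cube_edgeE:
  assumes "{u, v} \<in> cube_edges n"
  obtains c where "length u = n" "length v = n" "c < n" "\<And>i. i < n \<Longrightarrow> u ! i \<noteq> v ! i \<longleftrightarrow> i = c"
proof -
  obtain u' v' where uv': "{u, v} = {u', v'}" "length u' = n" "length v' = n"
    "card {i. i < n \<and> u' ! i \<noteq> v' ! i} = 1"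
    using assms by (auto simp: cube_edges_def cube_verts_def)
  have "length u = n" "length v = n" using uv'(1-3) by (auto simp: doubleton_eq_iff)
  moreover have "{i. i < n \<and> u ! i \<noteq> v ! i} = {i. i < n \<and> u' ! i \<noteq> v' ! i}"
    using uv'(1) by (auto simp: doubleton_eq_iff)
  then have "card {i. i < n \<and> u ! i \<noteq> v ! i} = 1" using uv'(4) by simp
  then obtain c where "{i. i < n \<and> u ! i \<noteq> v ! i} = {c}" by (auto simp: card_1_singleton_iff)
  then have "c < n" "\<And>i. i < n \<Longrightarrow> u ! i \<noteq> v ! i \<longleftrightarrow> i = c" by auto
  ultimately show ?thesis using that by blast
qed

lemma ex_moved_position:
  fixes u v :: "bool list"
  assumes "inj_on (\<lambda>i. (u ! i, v ! i)) {i \<in> {..<n}. \<tau> i = i}" "3 \<le> card {i. i < n \<and> u ! i = b}"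
  shows "\<exists>i. \<tau> i \<noteq> i \<and> u ! i = b"
proof -
  let ?A = "{i. i < n \<and> u ! i = b}"
  have "inj_on (\<lambda>i. (u ! i, v ! i)) {i \<in> ?A. \<tau> i = i}"
    using assms(1) by (rule inj_on_subset) auto
  then have "card ?A \<le> card {i \<in> ?A. \<tau> i \<noteq> i} + card {(b, True), (b, False)}"
    by (rule card_le_card_moved_plus[rotated]) auto
  then have "1 \<le> card {i \<in> ?A. \<tau> i \<noteq> i}" using assms(2) by simp
  then have "{i \<in> ?A. \<tau> i \<noteq> i} \<noteq> {}" by (metis card.empty not_one_le_zero)
  then show ?thesis by blast
qed

lemma obtain_involution_fixing_edge:
  assumes edge: "{u, v} \<in> cube_edges n"
  obtains \<tau> where "\<tau> permutes {..<n}" "\<tau> \<circ> \<tau> = id" "act_edge \<tau> {u, v} = {u, v}"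
    "n \<le> card {i. \<tau> i \<noteq> i} + 3" "\<And>i. \<tau> i \<noteq> i \<Longrightarrow> u ! i = v ! i"
    "\<And>b. 3 \<le> card {i. i < n \<and> u ! i = b} \<Longrightarrow> \<exists>i. \<tau> i \<noteq> i \<and> u ! i = b"
proof -
  obtain c where len: "length u = n" "length v = n"
    and c: "c < n" "\<And>i. i < n \<Longrightarrow> u ! i \<noteq> v ! i \<longleftrightarrow> i = c"
    using cube_edgeE[OF edge] by blast
  define bits where "bits i = (u ! i, v ! i)" for i
  obtain \<tau> where \<tau>: "\<tau> permutes {..<n}" "\<tau> \<circ> \<tau> = id" "\<And>i. bits (\<tau> i) = bits i"
    "inj_on bits {i \<in> {..<n}. \<tau> i = i}"
    using ex_involution_preserving[of "{..<n}" bits] by auto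
  have val: "u ! \<tau> i = u ! i" "v ! \<tau> i = v ! i" for i using \<tau>(3)[of i] by (auto simp: bits_def)
  have moved_lt: "i < n" if "\<tau> i \<noteq> i" for i
    using that permutes_not_in[OF \<tau>(1), of i] by auto
  have "\<tau> c < n" using permutes_in_image[OF \<tau>(1), of c] c(1) by simp
  then have "\<tau> c = c" using c(2)[of "\<tau> c"] c(2)[of c] c(1) val[of c] by simp
  then have agree: "u ! i = v ! i" if "\<tau> i \<noteq> i" for i
    using that c(2)[OF moved_lt[OF that]] \<open>\<tau> c = c\<close> by auto
  have "act_vert \<tau> u = u" "act_vert \<tau> v = v" using act_vert_eqI[OF \<tau>(1)] len val by auto
  then have "act_edge \<tau> {u, v} = {u, v}" by (simp add: act_edge_def)
  moreover have "n \<le> card {i. \<tau> i \<noteq> i} + 3"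
  proof -
    have "bits ` {..<n} \<subseteq> {(True, True), (False, False), bits c}"
      using c(2) by (auto simp: bits_def)
    then have "n \<le> card {i \<in> {..<n}. \<tau> i \<noteq> i} + card {(True, True), (False, False), bits c}"
      using card_le_card_moved_plus[OF finite_lessThan \<tau>(4)] by simp
    moreover have "{i \<in> {..<n}. \<tau> i \<noteq> i} = {i. \<tau> i \<noteq> i}" using moved_lt by auto
    moreover have "card {(True, True), (False, False), bits c} \<le> 3" by (simp add: card_insert_if)
    ultimately show ?thesis by simp
  qed
  moreover have "\<exists>i. \<tau> i \<noteq> i \<and> u ! i = b" if "3 \<le> card {i. i < n \<and> u ! i = b}" for b
    using \<tau>(4) that unfolding bits_def by (rule ex_moved_position)
  ultimately show ?thesis using that[OF \<tau>(1,2)] agree by blast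
qed

section \<open>Automorphisms of circuits\<close>

lemma rooted_dag_aut_permutes: "rooted_dag_aut C \<sigma> \<Longrightarrow> \<sigma> permutes gates C"
  by (simp add: rooted_dag_aut_def)

lemma rooted_dag_aut_gates: "rooted_dag_aut C \<sigma> \<Longrightarrow> \<sigma> g \<in> gates C \<longleftrightarrow> g \<in> gates C"
  by (simp add: rooted_dag_aut_def permutes_in_image)

lemma rooted_dag_aut_comp:
  "rooted_dag_aut C \<sigma> \<Longrightarrow> rooted_dag_aut C \<rho> \<Longrightarrow> rooted_dag_aut C (\<sigma> \<circ> \<rho>)"
  by (auto simp: rooted_dag_aut_def permutes_compose permutes_in_image)

lemma rooted_dag_aut_inv:
  assumes "rooted_dag_aut C \<sigma>"
  shows "rooted_dag_aut C (inv \<sigma>)"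
proof -
  note perm = rooted_dag_aut_permutes[OF assms]
  have "(inv \<sigma> g, inv \<sigma> h) \<in> wires C \<longleftrightarrow> (g, h) \<in> wires C" if "g \<in> gates C" "h \<in> gates C" for g h
    using assms that permutes_inverses(1)[OF perm] permutes_in_image[OF permutes_inv[OF perm]]
    unfolding rooted_dag_aut_def by metis
  then show ?thesis
    using assms permutes_inv[OF perm] permutes_inverses(2)[OF perm]
    unfolding rooted_dag_aut_def by metis
qed

locale cube_circuit =
  fixes n :: nat and C :: "'g circuit"
  assumes xor_circuit: "xor_circuit n C"
begin

lemma wires: "wires C \<subseteq> gates C \<times> gates C"
  using xor_circuit by (simp add: xor_circuit_def)

lemma finite_gates: "finite (gates C)"
  using xor_circuit by (simp add: xor_circuit_def)

lemma root_gate: "root_gate C \<in> gates C"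
  using xor_circuit by (simp add: xor_circuit_def)

lemma wf_wires: "wf ((wires C)\<inverse>)"
  using xor_circuit wires finite_gates unfolding xor_circuit_def
  by (meson finite_SigmaI finite_acyclic_wf_converse finite_subset)

lemma children_gates: "h \<in> children C g \<Longrightarrow> h \<in> gates C"
  using wires by (auto simp: children_def)

lemma finite_children: "finite (children C g)"
  using children_gates finite_gates by (meson finite_subset subsetI)

lemma elabel_in_cube_edges: "g \<in> input_gates C \<Longrightarrow> elabel C g \<in> cube_edges n"
  using xor_circuit by (auto simp: xor_circuit_def)

lemma elabel_eq_iff:
  "g \<in> input_gates C \<Longrightarrow> h \<in> input_gates C \<Longrightarrow> elabel C g = elabel C h \<longleftrightarrow> g = h"
  using xor_circuit by (auto simp: xor_circuit_def dest: inj_onD)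

lemma rooted_dag_aut_children:
  assumes "rooted_dag_aut C \<sigma>" "g \<in> gates C"
  shows "children C (\<sigma> g) = \<sigma> ` children C g"
proof (intro equalityI subsetI)
  fix h assume "h \<in> children C (\<sigma> g)"
  then have h: "(\<sigma> g, h) \<in> wires C" by (simp add: children_def)
  then have "h \<in> \<sigma> ` gates C"
    using wires permutes_image[OF rooted_dag_aut_permutes[OF assms(1)]] by auto
  then show "h \<in> \<sigma> ` children C g"
    using h assms by (auto simp: children_def rooted_dag_aut_def)
next
  fix h assume "h \<in> \<sigma> ` children C g"
  then show "h \<in> children C (\<sigma> g)"
    using assms wires by (auto simp: children_def rooted_dag_aut_def)
qed

lemma rooted_dag_aut_input_gates:
  assumes "rooted_dag_aut C \<sigma>"
  shows "\<sigma> g \<in> input_gates C \<longleftrightarrow> g \<in> input_gates C"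
  using rooted_dag_aut_gates[OF assms] rooted_dag_aut_children[OF assms]
  by (auto simp: input_gates_def)

lemma extends_to_comp:
  assumes "\<pi> permutes {..<n}" "\<rho> permutes {..<n}" "extends_to C \<pi> \<sigma>" "extends_to C \<rho> \<sigma>'"
  shows "extends_to C (\<pi> \<circ> \<rho>) (\<sigma> \<circ> \<sigma>')"
  using assms rooted_dag_aut_comp rooted_dag_aut_input_gates elabel_in_cube_edges
    act_edge_comp[OF assms(1,2)]
  by (auto simp: extends_to_def)

lemma extends_to_inv:
  assumes "\<pi> permutes {..<n}" "extends_to C \<pi> \<sigma>"
  shows "extends_to C (inv \<pi>) (inv \<sigma>)"
proof -
  have aut: "rooted_dag_aut C \<sigma>" using assms(2) by (simp add: extends_to_def)
  note inv_aut = rooted_dag_aut_inv[OF aut]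
  have "elabel C (inv \<sigma> g) = act_edge (inv \<pi>) (elabel C g)" if g: "g \<in> input_gates C" for g
  proof -
    have input: "inv \<sigma> g \<in> input_gates C"
      using rooted_dag_aut_input_gates[OF inv_aut] g by simp
    then have "elabel C g = act_edge \<pi> (elabel C (inv \<sigma> g))"
      using assms(2) permutes_inverses(1)[OF rooted_dag_aut_permutes[OF aut]]
      by (metis extends_to_def)
    then show ?thesis
      using act_edge_comp[OF permutes_inv[OF assms(1)] assms(1) elabel_in_cube_edges[OF input]]
        permutes_inv_o(2)[OF assms(1)] act_edge_id by metis
  qed
  then show ?thesis using inv_aut by (simp add: extends_to_def)
qed

lemma extends_to_id: "extends_to C id id"
  by (simp add: extends_to_def rooted_dag_aut_def act_edge_id permutes_id)

lemma extends_to_funpow: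
  assumes "\<pi> permutes {..<n}" "extends_to C \<pi> \<sigma>"
  shows "extends_to C (\<pi> ^^ k) (\<sigma> ^^ k)"
proof (induction k)
  case 0
  then show ?case using extends_to_id by (simp add: id_def)
next
  case (Suc k)
  then show ?case
    using extends_to_comp[OF assms(1) permutes_funpow[OF assms(1)] assms(2)]
    by (simp only: funpow.simps)
qed

lemma ex_extension_of_two_power_order:
  assumes "\<tau> permutes {..<n}" "\<tau> \<circ> \<tau> = id" "extends_to C \<tau> \<sigma>"
  shows "\<exists>\<rho> k. extends_to C \<tau> \<rho> \<and> \<rho> ^^ 2 ^ k = id"
proof -
  have "\<sigma> permutes gates C" using assms(3) by (simp add: extends_to_def rooted_dag_aut_permutes)
  then obtain N k where N: "odd N" "(\<sigma> ^^ N) ^^ 2 ^ k = id"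
    using ex_odd_power_with_two_power_order finite_gates by blast
  moreover have "extends_to C \<tau> (\<sigma> ^^ N)"
    using extends_to_funpow[OF assms(1,3), of N] funpow_odd_involution[OF assms(2) N(1)] by simp
  ultimately show ?thesis by blast
qed

lemma extends_to_fixes_input_gate:
  assumes "g \<in> input_gates C" "extends_to C \<pi> \<sigma>" "act_edge \<pi> (elabel C g) = elabel C g"
  shows "\<sigma> g = g"
proof -
  have "\<sigma> g \<in> input_gates C"
    using assms(1,2) rooted_dag_aut_input_gates by (simp add: extends_to_def)
  moreover have "elabel C (\<sigma> g) = elabel C g" using assms by (simp add: extends_to_def)
  ultimately show ?thesis using assms(1) elabel_eq_iff by blast
qed

end

section \<open>Gate stabilisers\<close>

context cube_circuit
begin

definition gate_stab :: "'g \<Rightarrow> (nat \<Rightarrow> nat) set" where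
  "gate_stab g = {\<pi>. \<pi> permutes {..<n} \<and> (\<exists>\<sigma>. extends_to C \<pi> \<sigma> \<and> \<sigma> g = g)}"

lemma gate_stabI: "\<pi> permutes {..<n} \<Longrightarrow> extends_to C \<pi> \<sigma> \<Longrightarrow> \<sigma> g = g \<Longrightarrow> \<pi> \<in> gate_stab g"
  by (auto simp: gate_stab_def)

lemma gate_stabE:
  assumes "\<pi> \<in> gate_stab g"
  obtains \<sigma> where "\<pi> permutes {..<n}" "extends_to C \<pi> \<sigma>" "\<sigma> permutes gates C" "\<sigma> g = g"
  using assms by (auto simp: gate_stab_def extends_to_def rooted_dag_aut_def)

lemma perm_group_gate_stab: "perm_group {..<n} (gate_stab g)"
proof
  fix \<pi> assume "\<pi> \<in> gate_stab g"
  then obtain \<sigma> where \<pi>: "\<pi> permutes {..<n}" "extends_to C \<pi> \<sigma>" "\<sigma> permutes gates C" "\<sigma> g = g"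
    by (rule gate_stabE)
  show "\<pi> permutes {..<n}" by (rule \<pi>)
  have "inv \<sigma> g = g" using \<pi>(3,4) by (metis permutes_inverses(2))
  then show "inv \<pi> \<in> gate_stab g"
    using \<pi>(1,2) extends_to_inv permutes_inv gate_stabI by blast
  fix \<rho> assume "\<rho> \<in> gate_stab g"
  then obtain \<sigma>' where \<rho>: "\<rho> permutes {..<n}" "extends_to C \<rho> \<sigma>'" "\<sigma>' g = g"
    by (rule gate_stabE)
  show "\<pi> \<circ> \<rho> \<in> gate_stab g"
    using permutes_compose[OF \<rho>(1) \<pi>(1)] extends_to_comp[OF \<pi>(1) \<rho>(1) \<pi>(2) \<rho>(2)]
    by (rule gate_stabI) (simp add: \<pi> \<rho>)
qed

lemma gate_stab_input_gate_nth:
  assumes "g \<in> input_gates C" "elabel C g = {u, v}" "\<pi> \<in> gate_stab g" "i < n"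
  shows "\<exists>w\<in>{u, v}. w ! \<pi> i = u ! i"
proof -
  have "length u = n" using elabel_in_cube_edges[OF assms(1)] assms(2) cube_edgeE by metis
  moreover have "\<pi> permutes {..<n}" using assms(3) by (rule gate_stabE)
  ultimately have "act_vert \<pi> u ! \<pi> i = u ! i" using act_vert_nth assms(4) by blast
  moreover have "act_edge \<pi> {u, v} = {u, v}"
    using assms(1-3) by (auto simp: gate_stab_def extends_to_def)
  then have "act_vert \<pi> u \<in> {u, v}" by (auto simp: act_edge_def)
  ultimately show ?thesis by blast
qed

lemma index_gate_stab_less:
  assumes "h \<in> gates C" "card (stab_orbit n C g h) < k"
  shows "index_less k (gate_stab g) (gate_stab h)"
  unfolding index_less_def
proof (intro allI impI)
  fix X assume X: "finite X" "X \<subseteq> gate_stab g" "k \<le> card X"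
  then have "\<forall>\<pi>\<in>X. \<exists>\<sigma>. \<pi> permutes {..<n} \<and> extends_to C \<pi> \<sigma> \<and> \<sigma> permutes gates C \<and> \<sigma> g = g"
    by (meson gate_stabE subsetD)
  then obtain lift where lift: "\<pi> permutes {..<n}" "extends_to C \<pi> (lift \<pi>)"
    "lift \<pi> permutes gates C" "lift \<pi> g = g" if "\<pi> \<in> X" for \<pi>
    by metis
  let ?image = "(\<lambda>\<pi>. lift \<pi> h) ` X"
  have "?image \<subseteq> stab_orbit n C g h"
    using lift unfolding stab_orbit_def circuit_aut_def by blast
  moreover have "stab_orbit n C g h \<subseteq> gates C"
    using assms(1) by (auto simp: stab_orbit_def circuit_aut_def extends_to_def rooted_dag_aut_gates)
  ultimately have "card ?image < k"
    using assms(2) finite_gates by (meson card_mono finite_subset le_less_trans)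
  then have "\<not> inj_on (\<lambda>\<pi>. lift \<pi> h) X" using X(3) by (auto dest: card_image)
  then obtain \<pi> \<rho> where \<pi>\<rho>: "\<pi> \<in> X" "\<rho> \<in> X" "\<pi> \<noteq> \<rho>" "lift \<pi> h = lift \<rho> h"
    by (auto simp: inj_on_def)
  have "inv \<pi> \<circ> \<rho> permutes {..<n}"
    using lift(1) \<pi>\<rho>(1,2) by (intro permutes_compose permutes_inv)
  moreover have "extends_to C (inv \<pi> \<circ> \<rho>) (inv (lift \<pi>) \<circ> lift \<rho>)"
    using lift(1,2) \<pi>\<rho>(1,2) by (intro extends_to_comp extends_to_inv permutes_inv)
  moreover have "(inv (lift \<pi>) \<circ> lift \<rho>) h = h"
    using \<pi>\<rho>(4) permutes_inverses(2)[OF lift(3)[OF \<pi>\<rho>(1)]] by (metis comp_apply)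
  ultimately have "inv \<pi> \<circ> \<rho> \<in> gate_stab h" by (rule gate_stabI)
  then show "\<exists>x\<in>X. \<exists>y\<in>X. x \<noteq> y \<and> inv x \<circ> y \<in> gate_stab h" using \<pi>\<rho> by blast
qed

end

section \<open>Sensitivity and fixed paths\<close>

definition affects :: "'g circuit \<Rightarrow> (bool list set \<Rightarrow> bool) \<Rightarrow> 'g \<Rightarrow> 'g \<Rightarrow> bool" where
  "affects C x g h \<longleftrightarrow> gate_val C (x(elabel C g := \<not> x (elabel C g))) h \<noteq> gate_val C x h"

lemma sensitive_to_iff_affects: "sensitive_to C g \<longleftrightarrow> (\<exists>x. affects C x g (root_gate C))"
  by (simp add: sensitive_to_def circuit_output_def affects_def)

context cube_circuit
begin

lemma affects_input_gate_iff:
  assumes "g \<in> input_gates C" "h \<in> input_gates C"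
  shows "affects C x g h \<longleftrightarrow> h = g"
  using assms elabel_eq_iff[OF assms]
  by (auto simp: affects_def gate_val_unfold[OF xor_circuit, of _ h] input_gates_def)

lemma affects_internal_gate_iff:
  assumes "children C h \<noteq> {}"
  shows "affects C x g h \<longleftrightarrow> odd (card {h' \<in> children C h. affects C x g h'})"
  using assms odd_card_filter_neq_iff[OF finite_children]
  by (simp add: affects_def gate_val_unfold[OF xor_circuit, of _ h])

context
  fixes g :: 'g and \<sigma> :: "'g \<Rightarrow> 'g"
  assumes input: "g \<in> input_gates C" and aut: "rooted_dag_aut C \<sigma>" and fixed: "\<sigma> g = g"
begin

lemma affects_rooted_dag_aut_iff: "h \<in> gates C \<Longrightarrow> affects C x g (\<sigma> h) \<longleftrightarrow> affects C x g h"
proof (induction h rule: wf_induct_rule[OF wf_wires, case_names less])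
  case (less h)
  have inj: "inj \<sigma>" using rooted_dag_aut_permutes[OF aut] by (rule permutes_inj)
  note children = rooted_dag_aut_children[OF aut less.prems]
  show ?case
  proof (cases "children C h = {}")
    case True
    then have "h \<in> input_gates C" "\<sigma> h \<in> input_gates C"
      using less.prems rooted_dag_aut_input_gates[OF aut] by (auto simp: input_gates_def)
    then show ?thesis using affects_input_gate_iff[OF input] fixed inj by (metis injD)
  next
    case False
    have "{h' \<in> \<sigma> ` children C h. affects C x g h'} = \<sigma> ` {h' \<in> children C h. affects C x g h'}"
      using less.IH children_gates by (auto simp: children_def)
    then have "card {h' \<in> children C (\<sigma> h). affects C x g h'} =
        card {h' \<in> children C h. affects C x g h'}"
      using children inj by (simp add: card_image inj_on_subset)
    then show ?thesis
      using affects_internal_gate_iff[of h] affects_internal_gate_iff[of "\<sigma> h"] False children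
      by simp
  qed
qed

lemma affects_fixed_child:
  assumes "\<sigma> ^^ 2 ^ k = id"
    and "h \<in> gates C" "\<sigma> h = h" "children C h \<noteq> {}" "affects C x g h"
  shows "\<exists>h'\<in>children C h. affects C x g h' \<and> \<sigma> h' = h'"
proof -
  let ?X = "{h' \<in> children C h. affects C x g h'}"
  have "\<sigma> ` ?X \<subseteq> ?X"
    using rooted_dag_aut_children[OF aut assms(2)] assms(3) affects_rooted_dag_aut_iff children_gates
    by auto
  then have "even (card {h' \<in> ?X. \<sigma> h' = h'}) \<longleftrightarrow> even (card ?X)"
    using finite_children assms(1) by (intro even_card_fixed_points_iff[of _ _ k]) auto
  then have "odd (card {h' \<in> ?X. \<sigma> h' = h'})"
    using affects_internal_gate_iff[OF assms(4)] assms(5) by simp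
  then have "{h' \<in> ?X. \<sigma> h' = h'} \<noteq> {}" by (metis card.empty even_zero)
  then show ?thesis by blast
qed

lemma affects_fixed_path:
  assumes "\<sigma> ^^ 2 ^ k = id"
  shows "h \<in> gates C \<Longrightarrow> \<sigma> h = h \<Longrightarrow> affects C x g h \<Longrightarrow> (h, g) \<in> (Restr (wires C) {h. \<sigma> h = h})\<^sup>*"
proof (induction h rule: wf_induct_rule[OF wf_wires, case_names less])
  case (less h)
  show ?case
  proof (cases "children C h = {}")
    case True
    then have "h = g"
      using affects_input_gate_iff[OF input, of h] less.prems by (simp add: input_gates_def)
    then show ?thesis by simp
  next
    case False
    then obtain h' where h': "h' \<in> children C h" "affects C x g h'" "\<sigma> h' = h'"
      using affects_fixed_child[OF assms less.prems(1,2)] less.prems(3) by blast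
    then have "(h, h') \<in> Restr (wires C) {h. \<sigma> h = h}"
      using less.prems(2) by (simp add: children_def)
    moreover have "(h', g) \<in> (Restr (wires C) {h. \<sigma> h = h})\<^sup>*"
      using less.IH[of h'] h' children_gates by (simp add: children_def)
    ultimately show ?thesis by (rule converse_rtrancl_into_rtrancl)
  qed
qed

lemma sensitive_fixed_path:
  assumes "sensitive_to C g" "\<sigma> ^^ 2 ^ k = id"
  shows "(root_gate C, g) \<in> (Restr (wires C) {h. \<sigma> h = h})\<^sup>*"
  using affects_fixed_path[OF assms(2) root_gate] assms(1) aut
  by (auto simp: sensitive_to_iff_affects rooted_dag_aut_def)

end

end

section \<open>Sensitive gates of symmetric circuits\<close>

locale symmetric_circuit = cube_circuit +
  assumes extendable: "\<pi> permutes {..<n} \<Longrightarrow> \<exists>\<sigma>. extends_to C \<pi> \<sigma>"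
begin

lemma contains_alt_gate_stab_root: "contains_alt (gate_stab (root_gate C)) {..<n}"
  unfolding contains_alt_def
proof (intro ballI impI)
  fix a b c assume "a \<in> {..<n}" "b \<in> {..<n}" "c \<in> {..<n}"
  then have perm: "three_cycle a b c permutes {..<n}"
    by (intro permutes_subset[OF three_cycle_permutes]) simp
  then obtain \<sigma> where \<sigma>: "extends_to C (three_cycle a b c) \<sigma>" using extendable by blast
  then have "\<sigma> (root_gate C) = root_gate C" by (simp add: extends_to_def rooted_dag_aut_def)
  with perm \<sigma> show "three_cycle a b c \<in> gate_stab (root_gate C)" by (rule gate_stabI)
qed

lemma sensitive_gate_stab_contains_alt:
  assumes g: "g \<in> input_gates C" "sensitive_to C g"
    and orbits: "\<And>h h'. (h, h') \<in> wires C \<Longrightarrow> card (stab_orbit n C h h') < q * q"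
    and \<tau>: "\<tau> permutes {..<n}" "\<tau> \<circ> \<tau> = id" "act_edge \<tau> (elabel C g) = elabel C g"
    and card_moved: "4 * q + 4 \<le> card {i. \<tau> i \<noteq> i}"
  shows "contains_alt (gate_stab g) {i. \<tau> i \<noteq> i}"
proof -
  obtain \<sigma> k where \<sigma>: "extends_to C \<tau> \<sigma>" "\<sigma> ^^ 2 ^ k = id"
    using extendable[OF \<tau>(1)] ex_extension_of_two_power_order[OF \<tau>(1,2)] by blast
  have aut: "rooted_dag_aut C \<sigma>" using \<sigma>(1) by (simp add: extends_to_def)
  have "\<sigma> g = g" using g(1) \<sigma>(1) \<tau>(3) by (rule extends_to_fixes_input_gate)
  then have path: "(root_gate C, g) \<in> (Restr (wires C) {h. \<sigma> h = h})\<^sup>*"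
    using sensitive_fixed_path[OF g(1) aut _ g(2) \<sigma>(2)] by simp
  have sub: "{i. \<tau> i \<noteq> i} \<subseteq> {..<n}" using permutes_not_in[OF \<tau>(1)] by blast
  have inj: "inj \<tau>" using \<tau>(1) by (rule permutes_inj)
  show ?thesis using path
  proof (induction rule: rtrancl_induct)
    case base
    show ?case using contains_alt_gate_stab_root sub by (auto simp: contains_alt_def)
  next
    case (step h h')
    then have wire: "(h, h') \<in> wires C" and fixed: "\<sigma> h' = h'" by auto
    have "index_less (q * q) (gate_stab h) (gate_stab h')"
      using index_gate_stab_less orbits[OF wire] wire wires by blast
    then interpret small_index_subgroup "{..<n}" "gate_stab h" "gate_stab h'" "{i. \<tau> i \<noteq> i}" q
      using step.IH card_moved finite_subset[OF sub]
      by (intro small_index_subgroup.intro perm_group_gate_stab small_index_subgroup_axioms.intro)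
        simp_all
    show ?case
      using gate_stabI[OF \<tau>(1) \<sigma>(1) fixed] inj
      by (intro contains_alt_if_fixed_point_free_element[of \<tau>]) (auto simp: inj_eq)
  qed
qed

lemma sensitive_unbalanced:
  assumes g: "g \<in> input_gates C" "sensitive_to C g" "elabel C g = {u, v}"
    and orbits: "\<And>h h'. (h, h') \<in> wires C \<Longrightarrow> card (stab_orbit n C h h') < q * q"
    and n: "4 * q + 7 \<le> n"
  shows "num_ones u < 3 \<or> num_zeros u < 3"
proof (rule ccontr)
  assume balanced: "\<not> ?thesis"
  have edge: "{u, v} \<in> cube_edges n" using elabel_in_cube_edges[OF g(1)] g(3) by simp
  then obtain \<tau> where \<tau>: "\<tau> permutes {..<n}" "\<tau> \<circ> \<tau> = id" "act_edge \<tau> {u, v} = {u, v}"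
    and many: "n \<le> card {i. \<tau> i \<noteq> i} + 3" and agree: "\<And>i. \<tau> i \<noteq> i \<Longrightarrow> u ! i = v ! i"
    and both: "\<And>b. 3 \<le> card {i. i < n \<and> u ! i = b} \<Longrightarrow> \<exists>i. \<tau> i \<noteq> i \<and> u ! i = b"
    using obtain_involution_fixing_edge by blast
  have alt: "contains_alt (gate_stab g) {i. \<tau> i \<noteq> i}"
    using sensitive_gate_stab_contains_alt[OF g(1,2) orbits \<tau>(1,2) _] \<tau>(3) many n g(3) by simp
  have "length u = n" using cube_edgeE[OF edge] by blast
  then obtain a b where ab: "\<tau> a \<noteq> a" "u ! a" "\<tau> b \<noteq> b" "\<not> u ! b"
    using balanced both[of True] both[of False] by (auto simp: num_ones_def num_zeros_def)
  have "card {a, b} < card {i. \<tau> i \<noteq> i}"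
    using many n by (simp add: card_insert_if)
  then obtain c where c: "\<tau> c \<noteq> c" "c \<notin> {a, b}"
    by (metis (mono_tags) card_mono finite.emptyI finite.insertI leD mem_Collect_eq subsetI)
  have distinct: "distinct [a, b, c]" using ab c(2) by auto
  then have "three_cycle a b c \<in> gate_stab g" using alt ab(1,3) c(1) by (simp add: contains_alt_def)
  moreover have "a < n" using permutes_not_in[OF \<tau>(1)] ab(1) by blast
  ultimately obtain w where "w \<in> {u, v}" "w ! three_cycle a b c a = u ! a"
    using gate_stab_input_gate_nth[OF g(1,3)] by blast
  then show False using ab(2,4) agree[OF ab(3)] distinct by auto
qed

end

lemma eventually_ex_square_greater_if_bigo_linear:
  fixes f :: "nat \<Rightarrow> real"
  assumes "f \<in> O(\<lambda>n. real n)"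
  shows "\<forall>\<^sub>F n in sequentially. \<exists>q. f n < real (q * q) \<and> 4 * q + 7 \<le> n"
proof -
  obtain K where "\<forall>\<^sub>F n in sequentially. norm (f n) \<le> K * norm (real n)"
    using assms by (elim landau_o.bigE)
  moreover have "\<forall>\<^sub>F n in sequentially. K * real n < ((real n - 10) / 4)\<^sup>2" by real_asymp
  ultimately show ?thesis using eventually_ge_at_top[of 10]
  proof eventually_elim
    case (elim n)
    define q where "q = (n - 7) div 4"
    have "(real n - 10) / 4 \<le> real q" using elim(3) by (auto simp: q_def)
    then have "((real n - 10) / 4)\<^sup>2 \<le> (real q)\<^sup>2"
      using elim(3) by (intro power_mono) auto
    moreover have "4 * q + 7 \<le> n" using elim(3) by (simp add: q_def)
    ultimately show ?case using elim(1,2) by (intro exI[of _ q]) (auto simp: power2_eq_square)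
  qed
qed

theorem theorem8p1:
  fixes C :: "nat \<Rightarrow> 'g circuit"
  assumes circ: "\<forall>n\<ge>1. xor_circuit n (C n)"
    and size: "\<exists>p :: real poly. \<forall>n\<ge>1. real (card (gates (C n))) \<le> poly p (2 ^ n)"
    and sym: "\<forall>n\<ge>1. \<forall>\<pi>. \<pi> permutes {..<n} \<longrightarrow> (\<exists>\<sigma>. extends_to (C n) \<pi> \<sigma>)"
    and orbits: "\<exists>f :: nat \<Rightarrow> real. f \<in> O(\<lambda>n. real n) \<and>
      (\<forall>\<^sub>F n in sequentially. \<forall>g\<in>gates (C n). \<forall>h\<in>parents (C n) g.
         real (card (stab_orbit n (C n) g h)) \<le> f n \<and>
         real (card (stab_orbit n (C n) h g)) \<le> f n)"
  shows "\<forall>\<epsilon>::real. \<epsilon> > 0 \<longrightarrow>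
    (\<forall>\<^sub>F n in sequentially. \<forall>g\<in>input_gates (C n). \<forall>u v.
       sensitive_to (C n) g \<and> elabel (C n) g = {u, v} \<longrightarrow>
       (\<exists>w\<in>{u, v}. real (num_ones w) < \<epsilon> * real n \<or> real (num_zeros w) < \<epsilon> * real n))"
proof (intro allI impI)
  fix \<epsilon> :: real assume "\<epsilon> > 0"
  then have large: "\<forall>\<^sub>F n in sequentially. 3 \<le> \<epsilon> * real n" by real_asymp
  obtain f where f: "f \<in> O(\<lambda>n. real n)" and bound:
    "\<forall>\<^sub>F n in sequentially. \<forall>g\<in>gates (C n). \<forall>h\<in>parents (C n) g.
       real (card (stab_orbit n (C n) g h)) \<le> f n \<and> real (card (stab_orbit n (C n) h g)) \<le> f n"
    using orbits by blast
  show "\<forall>\<^sub>F n in sequentially. \<forall>g\<in>input_gates (C n). \<forall>u v.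
      sensitive_to (C n) g \<and> elabel (C n) g = {u, v} \<longrightarrow>
      (\<exists>w\<in>{u, v}. real (num_ones w) < \<epsilon> * real n \<or> real (num_zeros w) < \<epsilon> * real n)"
    using large bound eventually_ex_square_greater_if_bigo_linear[OF f] eventually_ge_at_top[of 1]
  proof eventually_elim
    case (elim n)
    interpret symmetric_circuit n "C n" using circ sym elim(4) by unfold_locales auto
    obtain q where q: "f n < real (q * q)" "4 * q + 7 \<le> n" using elim(3) by blast
    have small: "card (stab_orbit n (C n) h h') < q * q" if "(h, h') \<in> wires (C n)" for h h'
    proof -
      have "h' \<in> gates (C n)" "h \<in> parents (C n) h'" using that wires by (auto simp: parents_def)
      then have "real (card (stab_orbit n (C n) h h')) < real (q * q)"
        using elim(2) q(1) by fastforce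
      then show ?thesis by (simp only: of_nat_less_iff)
    qed
    have "real (num_ones u) < \<epsilon> * real n \<or> real (num_zeros u) < \<epsilon> * real n"
      if "g \<in> input_gates (C n)" "sensitive_to (C n) g" "elabel (C n) g = {u, v}" for g u v
      using sensitive_unbalanced[OF that small q(2)] elim(1) by linarith
    then show ?case by blast
  qed
qed

end
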